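(* Consider the Fubuki game with prescribed diagonal: one must fill a $3\times 3$ grid with the numbers $1,2,\ldots,9$, each used exactly once, such that the three diagonal entries $s_{1,1},s_{2,2},s_{3,3}$ take prescribed values and each row and each column adds up to a prescribed sum (three given row sums and three given column sums). Let \[ \mathcal{D}:=\big\{\{1,3,4\},\{1,3,6\},\{1,4,6\},\{1,5,7\},\{1,5,8\},\{1,7,8\},\{2,3,4\},\{2,3,5\},\{2,3,6\},\{2,3,8\},\{2,3,9\},\{2,4,6\},\{2,4,7\},\{2,4,8\},\{2,5,6\},\{2,5,9\},\{2,6,7\},\{2,6,8\},\{2,7,8\},\{3,4,6\},\{3,4,8\},\{3,5,6\},\{3,5,7\},\{3,5,9\},\{3,6,8\},\{4,5,7\},\{4,5,8\},\{4,6,7\},\{4,6,8\},\{4,6,9\},\{4,7,8\},\{4,7,9\},\{5,7,8\},\{6,7,8\},\{6,7,9\}\big\}. \] (a) If the set of prescribed diagonal values $\{s_{1,1},s_{2,2},s_{3,3}\}$ belongs to $\mathcal{D}$, then, whatever the prescribed row and column sums, if a solution exists it is unique. (b) If the set of prescribed diagonal values does not belong to $\mathcal{D}$, then, whatever the prescribed row and column sums, there are at most $2$ solutions.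
   Context: A solution is a $3\times 3$ array $(s_{i,j})$ whose nine entries are exactly $1,\ldots,9$ (each once), whose diagonal entries equal the prescribed values, and whose row sums and column sums equal the prescribed sums. *)

theory Defs
  imports "HOL-Analysis.Analysis"
begin

text \<open>
  Grids are matrices over the three-element index type \<open>3\<close>, whose elements are \<open>1\<close>, \<open>2\<close> and
  \<open>3\<close> (with \<open>3 = 0\<close>); the entry in row \<open>i\<close> and column \<open>j\<close> is \<open>s $ i $ j\<close>. The vectors \<open>d\<close>, \<open>r\<close>, \<open>c\<close>
  hold the prescribed diagonal entries, row sums and column sums. They are arbitrary: data that no
  grid satisfies simply have no solution.
\<close>

definition fubuki_solution ::
    "nat ^ 3 \<Rightarrow> nat ^ 3 \<Rightarrow> nat ^ 3 \<Rightarrow> nat ^ 3 ^ 3 \<Rightarrow> bool" where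
  "fubuki_solution d r c s \<longleftrightarrow>
     bij_betw (\<lambda>(i, j). s $ i $ j) UNIV {1..9} \<and>
     (\<forall>i. s $ i $ i = d $ i) \<and>
     (\<forall>i. (\<Sum>j\<in>UNIV. s $ i $ j) = r $ i) \<and>
     (\<forall>j. (\<Sum>i\<in>UNIV. s $ i $ j) = c $ j)"

definition unique_diagonals :: "nat set set" where
  "unique_diagonals =
     {{1, 3, 4}, {1, 3, 6}, {1, 4, 6}, {1, 5, 7}, {1, 5, 8},
      {1, 7, 8}, {2, 3, 4}, {2, 3, 5}, {2, 3, 6}, {2, 3, 8},
      {2, 3, 9}, {2, 4, 6}, {2, 4, 7}, {2, 4, 8}, {2, 5, 6},
      {2, 5, 9}, {2, 6, 7}, {2, 6, 8}, {2, 7, 8}, {3, 4, 6},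
      {3, 4, 8}, {3, 5, 6}, {3, 5, 7}, {3, 5, 9}, {3, 6, 8},
      {4, 5, 7}, {4, 5, 8}, {4, 6, 7}, {4, 6, 8}, {4, 6, 9},
      {4, 7, 8}, {4, 7, 9}, {5, 7, 8}, {6, 7, 8}, {6, 7, 9}}"

end

theory Submission
  imports Defs
begin

text \<open>
  Two solutions with the same data differ by a matrix with zero diagonal and zero row and column
  sums, that is, by \<open>t\<close> times the cyclic pattern with \<open>1\<close> at \<open>(1,2)\<close>, \<open>(2,3)\<close>, \<open>(3,1)\<close> and \<open>- 1\<close>
  at the opposite places. The sum of the squares of all entries is the same for all solutions,
  which is a quadratic equation for \<open>t\<close>: there are at most two solutions. If \<open>t \<noteq> 0\<close>,
  then every off-diagonal value has another off-diagonal value at distance \<open>\<bar>t\<bar>\<close>; for the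
  complements of the listed diagonals no \<open>t\<close> satisfies even this necessary condition.
\<close>

text \<open>Otherwise the set, infinite or not, has a subset of exactly three elements. Finiteness
  is claimed separately since \<open>card\<close> of an infinite set is 0.\<close>

lemma finite_card_le_2I:
  assumes "\<And>x y z. x \<in> A \<Longrightarrow> y \<in> A \<Longrightarrow> z \<in> A \<Longrightarrow> x = y \<or> x = z \<or> y = z"
  shows "finite A \<and> card A \<le> 2"
proof (rule ccontr)
  assume "\<not> (finite A \<and> card A \<le> 2)"
  then have "infinite A \<or> 3 \<le> card A"
    by linarith
  then obtain B where "B \<subseteq> A" "card B = 3"
    by (metis infinite_arbitrarily_large obtain_subset_with_card_n)
  with assms show False
    by (auto simp: card_3_iff)
qed

definition cyclic_shift :: "int \<Rightarrow> nat ^ 3 ^ 3 \<Rightarrow> nat ^ 3 ^ 3 \<Rightarrow> bool" where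
  "cyclic_shift t s s' \<longleftrightarrow>
     s' $ 1 $ 1 = s $ 1 $ 1 \<and> s' $ 2 $ 2 = s $ 2 $ 2 \<and> s' $ 3 $ 3 = s $ 3 $ 3 \<and>
     int (s' $ 1 $ 2) = int (s $ 1 $ 2) + t \<and>
     int (s' $ 2 $ 3) = int (s $ 2 $ 3) + t \<and>
     int (s' $ 3 $ 1) = int (s $ 3 $ 1) + t \<and>
     int (s' $ 2 $ 1) = int (s $ 2 $ 1) - t \<and>
     int (s' $ 3 $ 2) = int (s $ 3 $ 2) - t \<and>
     int (s' $ 1 $ 3) = int (s $ 1 $ 3) - t"

lemma cyclic_shift_0: "cyclic_shift 0 s s' \<Longrightarrow> s' = s"
  by (simp add: cyclic_shift_def vec_eq_iff forall_3)

lemma cyclic_shift_unique: "cyclic_shift t s s' \<Longrightarrow> cyclic_shift t s s'' \<Longrightarrow> s' = s''"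
  by (simp add: cyclic_shift_def vec_eq_iff forall_3 flip: of_nat_eq_iff)

lemma cyclic_shift_sym: "cyclic_shift t s s' \<Longrightarrow> cyclic_shift (- t) s' s"
  by (auto simp: cyclic_shift_def)

lemma solutions_cyclic_shift:
  assumes "fubuki_solution d r c s" "fubuki_solution d r c s'"
  obtains t where "cyclic_shift t s s'"
proof
  have diag: "s' $ i $ i = s $ i $ i" for i
    using assms by (simp add: fubuki_solution_def)
  have row: "(\<Sum>j\<in>UNIV. s' $ i $ j) = (\<Sum>j\<in>UNIV. s $ i $ j)"
    and col: "(\<Sum>j\<in>UNIV. s' $ j $ i) = (\<Sum>j\<in>UNIV. s $ j $ i)" for i
    using assms by (simp_all add: fubuki_solution_def)
  have "s' $ 1 $ 2 + s' $ 1 $ 3 = s $ 1 $ 2 + s $ 1 $ 3"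
    "s' $ 2 $ 1 + s' $ 2 $ 3 = s $ 2 $ 1 + s $ 2 $ 3"
    "s' $ 3 $ 1 + s' $ 3 $ 2 = s $ 3 $ 1 + s $ 3 $ 2"
    using row[of 1] row[of 2] row[of 3] by (simp_all add: sum_3 diag)
  moreover have "s' $ 2 $ 1 + s' $ 3 $ 1 = s $ 2 $ 1 + s $ 3 $ 1"
    "s' $ 1 $ 2 + s' $ 3 $ 2 = s $ 1 $ 2 + s $ 3 $ 2"
    using col[of 1] col[of 2] by (simp_all add: sum_3 diag)
  \<comment> \<open>The change at (1,2) determines the rest with alternating signs: row 1 gives
    (1,3), column 2 gives (3,2), row 3 gives (3,1), column 1 gives (2,1), row 2 gives (2,3).\<close>
  ultimately show "cyclic_shift (int (s' $ 1 $ 2) - int (s $ 1 $ 2)) s s'"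
    unfolding cyclic_shift_def diag by (intro conjI refl; linarith)
qed

lemma solution_sum_squares:
  assumes "fubuki_solution d r c s"
  shows "(\<Sum>i\<in>UNIV. \<Sum>j\<in>UNIV. (int (s $ i $ j))\<^sup>2) = (\<Sum>k\<in>{1..9}. (int k)\<^sup>2)"
proof -
  have "(\<Sum>i\<in>UNIV. \<Sum>j\<in>UNIV. (int (s $ i $ j))\<^sup>2) =
      (\<Sum>p\<in>UNIV. (int ((\<lambda>(i, j). s $ i $ j) p))\<^sup>2)"
    by (simp add: sum.cartesian_product case_prod_unfold)
  also have "\<dots> = (\<Sum>k\<in>{1..9}. (int k)\<^sup>2)"
    using assms unfolding fubuki_solution_def
    by (intro sum.reindex_bij_betw) blast
  finally show ?thesis .
qed

lemma solutions_shift_amount: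
  assumes s: "fubuki_solution d r c s" and s': "fubuki_solution d r c s'"
    and shift: "cyclic_shift t s s'" and "t \<noteq> 0"
  shows "3 * t = int (s $ 2 $ 1 + s $ 3 $ 2 + s $ 1 $ 3) - int (s $ 1 $ 2 + s $ 2 $ 3 + s $ 3 $ 1)"
proof -
  have "(\<Sum>i\<in>UNIV. \<Sum>j\<in>UNIV. (int (s' $ i $ j))\<^sup>2) = (\<Sum>i\<in>UNIV. \<Sum>j\<in>UNIV. (int (s $ i $ j))\<^sup>2)"
    using s s' by (simp add: solution_sum_squares)
  \<comment> \<open>With P and N the sums of \<open>s\<close> over the raised and the lowered
    positions, the squares change by 6 t^2 + 2 t (P - N).\<close>
  then have "2 * t * (3 * t - (int (s $ 2 $ 1 + s $ 3 $ 2 + s $ 1 $ 3) -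
      int (s $ 1 $ 2 + s $ 2 $ 3 + s $ 3 $ 1))) = 0"
    using shift unfolding cyclic_shift_def
    by (simp add: sum_3 power2_eq_square algebra_simps)
  with \<open>t \<noteq> 0\<close> show ?thesis
    by simp
qed

lemma solutions_at_most_two:
  assumes s: "fubuki_solution d r c s" and s': "fubuki_solution d r c s'"
    and s'': "fubuki_solution d r c s''"
  shows "s = s' \<or> s = s'' \<or> s' = s''"
proof -
  obtain t u where t: "cyclic_shift t s s'" and u: "cyclic_shift u s s''"
    using solutions_cyclic_shift s s' s'' by metis
  \<comment> \<open>Both sides equal the same expression in \<open>s\<close> alone, so the nonzero
    shift from \<open>s\<close> is determined.\<close>
  have "3 * t = 3 * u" if "t \<noteq> 0" "u \<noteq> 0"
    using solutions_shift_amount[OF s s' t] solutions_shift_amount[OF s s'' u] that by simp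
  then have "t = 0 \<or> u = 0 \<or> t = u"
    by auto
  then show ?thesis
    using t u cyclic_shift_0[of s s'] cyclic_shift_0[of s s''] cyclic_shift_unique[of t s s' s'']
    by blast
qed

text \<open>The left side depends on \<open>d\<close> only, so solutions for the same data share
  their off-diagonal values.\<close>

lemma solution_values:
  assumes "fubuki_solution d r c s"
  shows "{1..9} - {d $ 1, d $ 2, d $ 3} =
    {s $ 1 $ 2, s $ 2 $ 3, s $ 3 $ 1, s $ 2 $ 1, s $ 3 $ 2, s $ 1 $ 3}"
proof -
  let ?f = "\<lambda>(i, j). s $ i $ j"
  have inj: "inj ?f" and range: "range ?f = {1..9}" and diag: "\<And>i. d $ i = s $ i $ i"
    using assms by (auto simp: fubuki_solution_def bij_betw_def)
  have "{1..9} - {d $ 1, d $ 2, d $ 3} = range ?f - ?f ` {(1, 1), (2, 2), (3, 3)}"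
    by (simp add: range diag)
  also have "\<dots> = ?f ` (UNIV - {(1, 1), (2, 2), (3, 3)})"
    using inj by (simp only: image_set_diff)
  also have "UNIV - {(1, 1), (2, 2), (3, 3)} =
      {(1, 2), (2, 3), (3, 1), (2, 1), (3, 2), (1, 3) :: 3 \<times> 3}"
    by (simp add: set_eq_iff forall_3)
  finally show ?thesis
    by simp
qed

text \<open>A finite check: for each listed diagonal and each distance \<open>t\<close>, some
  off-diagonal value has no partner at that distance. Writing \<open>y + t\<close> avoids truncated
  subtraction.\<close>

lemma unique_diagonal_complement:
  assumes "D \<in> unique_diagonals" "t \<in> {1..8}"
  shows "\<exists>x\<in>{1..9} - D. x + t \<notin> {1..9} - D \<and> (\<forall>y\<in>{1..9} - D. y + t \<noteq> x)"
proof -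
  have ivl: "{1..8} = {1, 2, 3, 4, 5, 6, 7, 8 :: nat}" "{1..9} = {1, 2, 3, 4, 5, 6, 7, 8, 9 :: nat}"
    by auto
  have "\<forall>D\<in>unique_diagonals. \<forall>t\<in>{1..8}.
      \<exists>x\<in>{1..9} - D. x + t \<notin> {1..9} - D \<and> (\<forall>y\<in>{1..9} - D. y + t \<noteq> x)"
    unfolding ivl unique_diagonals_def by (simp add: insert_Diff_if)
  with assms show ?thesis
    by blast
qed

lemma unique_diagonal_not_shift_pos:
  assumes s: "fubuki_solution d r c s" and s': "fubuki_solution d r c s'"
    and D: "{d $ 1, d $ 2, d $ 3} \<in> unique_diagonals"
    and shift: "cyclic_shift t s s'"
  shows "t \<le> 0"
proof (rule ccontr)
  assume "\<not> t \<le> 0"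
  then obtain u where u: "t = int u" "0 < u"
    by (metis linorder_not_le pos_int_cases)
  let ?S = "{1..9} - {d $ 1, d $ 2, d $ 3}"
  note S = solution_values[OF s] and S' = solution_values[OF s']
  have eqs: "s' $ 1 $ 2 = s $ 1 $ 2 + u" "s' $ 2 $ 3 = s $ 2 $ 3 + u" "s' $ 3 $ 1 = s $ 3 $ 1 + u"
    "s $ 2 $ 1 = s' $ 2 $ 1 + u" "s $ 3 $ 2 = s' $ 3 $ 2 + u" "s $ 1 $ 3 = s' $ 1 $ 3 + u"
    using shift by (auto simp: cyclic_shift_def u)
  \<comment> \<open>Two values in 1..9 that differ by \<open>u\<close> bound it by 8.\<close>
  have "s $ 1 $ 2 \<in> ?S" "s' $ 1 $ 2 \<in> ?S"
    by (simp only: S, simp, simp only: S', simp)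
  then have "u \<in> {1..8}"
    using eqs u by auto
  \<comment> \<open>At a raised position of \<open>s\<close> the partner is the new value
    \<open>x + u\<close>; at a lowered one it is the new value \<open>y\<close> with
    \<open>y + u = x\<close>. Both are entries of \<open>s'\<close>, hence in the common
    set.\<close>
  have "x + u \<in> ?S \<or> (\<exists>y\<in>?S. y + u = x)" if "x \<in> ?S" for x
  proof -
    have "x \<in> {s $ 1 $ 2, s $ 2 $ 3, s $ 3 $ 1} \<or> x \<in> {s $ 2 $ 1, s $ 3 $ 2, s $ 1 $ 3}"
      using that unfolding S by blast
    then show ?thesis
      unfolding S' using eqs by auto
  qed
  with unique_diagonal_complement[OF D \<open>u \<in> {1..8}\<close>] show False
    by blast
qed

theorem theorem1p1:
  fixes d :: "nat ^ 3"
  shows "({d $ 1, d $ 2, d $ 3} \<in> unique_diagonals \<longrightarrow>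
           (\<forall>r c s s'. fubuki_solution d r c s \<longrightarrow> fubuki_solution d r c s' \<longrightarrow> s = s'))
       \<and> ({d $ 1, d $ 2, d $ 3} \<notin> unique_diagonals \<longrightarrow>
           (\<forall>r c. finite {s. fubuki_solution d r c s} \<and> card {s. fubuki_solution d r c s} \<le> 2))"
proof (intro conjI impI)
  assume D: "{d $ 1, d $ 2, d $ 3} \<in> unique_diagonals"
  show "\<forall>r c s s'. fubuki_solution d r c s \<longrightarrow> fubuki_solution d r c s' \<longrightarrow> s = s'"
  proof (intro allI impI)
    fix r c s s'
    assume s: "fubuki_solution d r c s" and s': "fubuki_solution d r c s'"
    obtain t where t: "cyclic_shift t s s'"
      using solutions_cyclic_shift[OF s s'] .
    \<comment> \<open>Exchanging the two solutions negates the shift, so both signs are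
      excluded.\<close>
    have "t \<le> 0" "- t \<le> 0"
      using unique_diagonal_not_shift_pos[OF s s' D t]
        unique_diagonal_not_shift_pos[OF s' s D cyclic_shift_sym[OF t]] .
    with t show "s = s'"
      by (auto dest: cyclic_shift_0)
  qed
next
  show "\<forall>r c. finite {s. fubuki_solution d r c s} \<and> card {s. fubuki_solution d r c s} \<le> 2"
    by (intro allI finite_card_le_2I) (auto dest: solutions_at_most_two)
qed

end
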